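(* Let $T$ be a tree set of characteristic $1$ on the alphabet $\Sigma$, closed under reversal (i.e. $a_1a_2\cdots a_n\in T$ implies $a_n\cdots a_2a_1\in T$). Let $\mathcal{A}$ be a doubling transducer with input alphabet $\Sigma$ and output alphabet $A$, and let $\delta_{\mathcal{A}}=(\delta_0,\delta_1)$ be the corresponding doubling map. Then the image $S=\delta_0(T)\cup\delta_1(T)$ of $T$ by $\delta_{\mathcal{A}}$ is a specular set on $A$ relative to the involution $\theta_{\mathcal{A}}$.
   Context: Words are over finite alphabets; $\varepsilon$ is the empty word. A set $S$ of words on an alphabet $A$ is factorial if it contains $A$ and all the factors of its elements. For $w\in S$ let $L(w)=\{a\in A\mid aw\in S\}$, $R(w)=\{a\in A\mid wa\in S\}$, $B(w)=\{(a,b)\in A\times A\mid awb\in S\}$. A factorial set $S$ is biextendable if $B(w)\neq\emptyset$ for all $w\in S$. The extension graph $\mathcal{E}(w)$ is the undirected graph whose vertex set is the disjoint union of $L(w)$ and $R(w)$ and whose edges are the pairs in $B(w)$. A biextendable set $S$ is a tree set of characteristic $c$ if $\mathcal{E}(w)$ is a tree for every nonempty $w\in S$ and $\mathcal{E}(\varepsilon)$ is a disjoint union of $c$ trees. Let $\theta$ be an involution on $A$ (possibly with fixed points) and let $G_\theta$ be the group generated by $A$ with relations $a\theta(a)=1$, $a\in A$ (so $a^{-1}=\theta(a)$). A word is reduced if it has no factor $a\theta(a)$ with $a\in A$; every element of $G_\theta$ is represented by a unique reduced word, so the inverse of a reduced word $a_1\cdots a_n$ is the reduced word $\theta(a_n)\cdots\theta(a_1)$.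 A laminary set on $A$ relative to $\theta$ is a biextendable set of reduced words closed under taking inverses. A specular set relative to $\theta$ is a laminary set which is a tree set of characteristic $2$. A doubling transducer $\mathcal{A}$ is a directed labeled graph with set of states $\{0,1\}$, each edge being of the form $(i,\alpha,a,j)$ (from state $i$ to state $j$, with input letter $\alpha\in\Sigma$ and output letter $a\in A$), such that: (1) every letter of $\Sigma$ acts on $\{0,1\}$ as a permutation (for each state $i$ and each $\alpha\in\Sigma$ there is exactly one edge leaving $i$ with input $\alpha$, and the map sending $i$ to the end of this edge is a permutation of $\{0,1\}$); (2) the output labels of the edges are all distinct. The alphabet $A$ is the set of output labels of the edges. For $i\in\{0,1\}$, the map $\delta_i:\Sigma^*\to A^*$ sends $u$ to the output label of the path starting at state $i$ with input label $u$. The involution $\theta_{\mathcal{A}}$ on $A$ is defined as follows: for $a\in A$, let $(i,\alpha,a,j)$ be the edge with output $a$; then $\theta_{\mathcal{A}}(a)$ is the output label of the edge starting at $1-j$ with input label $\alpha$. *)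

theory Defs
  imports "HOL-Library.Sublist" "Graph_Theory.Digraph_Component"
begin

section \<open>Factorial and biextendable sets of words\<close>

text \<open>Words are lists, alphabets are finite sets of letters, and factors are contiguous
  sublists (\<^const>\<open>sublist\<close>).\<close>

definition factorial_set :: "'a set \<Rightarrow> 'a list set \<Rightarrow> bool" where
  "factorial_set A S \<longleftrightarrow> finite A \<and> S \<subseteq> lists A \<and> (\<forall>a\<in>A. [a] \<in> S)
     \<and> (\<forall>w\<in>S. \<forall>u. sublist u w \<longrightarrow> u \<in> S)"

definition left_ext :: "'a set \<Rightarrow> 'a list set \<Rightarrow> 'a list \<Rightarrow> 'a set" where
  "left_ext A S w = {a \<in> A. a # w \<in> S}"

definition right_ext :: "'a set \<Rightarrow> 'a list set \<Rightarrow> 'a list \<Rightarrow> 'a set" where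
  "right_ext A S w = {a \<in> A. w @ [a] \<in> S}"

definition bi_ext :: "'a set \<Rightarrow> 'a list set \<Rightarrow> 'a list \<Rightarrow> ('a \<times> 'a) set" where
  "bi_ext A S w = {(a, b) \<in> A \<times> A. a # w @ [b] \<in> S}"

definition biextendable :: "'a set \<Rightarrow> 'a list set \<Rightarrow> bool" where
  "biextendable A S \<longleftrightarrow> factorial_set A S \<and> (\<forall>w\<in>S. bi_ext A S w \<noteq> {})"


section \<open>Extension graphs and tree sets\<close>

text \<open>An undirected graph is represented, as usual in the graph library, by a symmetric digraph
  (\<^locale>\<open>pair_graph\<close>). The library's \<^const>\<open>tree\<close> forbids all directed cycles, hence also
  \<open>u, v, u\<close>, so no symmetric digraph with an edge satisfies it. In an undirected simple
  graph a cycle has at least three edges.\<close>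

definition undirected_tree :: "'v pair_pre_digraph \<Rightarrow> bool" where
  "undirected_tree G \<longleftrightarrow> pair_graph G \<and> Digraph_Component.connected (with_proj G)
     \<and> \<not> (\<exists>p. pre_digraph.cycle (with_proj G) p \<and> 3 \<le> length p)"

definition disjoint_union_of_trees :: "nat \<Rightarrow> 'v pair_pre_digraph \<Rightarrow> bool" where
  "disjoint_union_of_trees c G \<longleftrightarrow> (\<exists>F. finite F \<and> card F = c
     \<and> (\<forall>H\<in>F. undirected_tree H)
     \<and> pairwise (\<lambda>H K. disjnt (pverts H) (pverts K)) F
     \<and> pverts G = (\<Union>H\<in>F. pverts H) \<and> parcs G = (\<Union>H\<in>F. parcs H))"

definition extension_graph :: "'a set \<Rightarrow> 'a list set \<Rightarrow> 'a list \<Rightarrow> ('a + 'a) pair_pre_digraph" where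
  "extension_graph A S w =
     \<lparr> pverts = left_ext A S w <+> right_ext A S w,
       parcs = (\<Union>(a, b) \<in> bi_ext A S w. {(Inl a, Inr b), (Inr b, Inl a)}) \<rparr>"

definition tree_set :: "'a set \<Rightarrow> nat \<Rightarrow> 'a list set \<Rightarrow> bool" where
  "tree_set A c S \<longleftrightarrow> biextendable A S
     \<and> (\<forall>w\<in>S. w \<noteq> [] \<longrightarrow> undirected_tree (extension_graph A S w))
     \<and> disjoint_union_of_trees c (extension_graph A S [])"


section \<open>Specular sets\<close>

definition involution_on :: "'a set \<Rightarrow> ('a \<Rightarrow> 'a) \<Rightarrow> bool" where
  "involution_on A \<theta> \<longleftrightarrow> (\<forall>a\<in>A. \<theta> a \<in> A \<and> \<theta> (\<theta> a) = a)"

definition reduced_word :: "'a set \<Rightarrow> ('a \<Rightarrow> 'a) \<Rightarrow> 'a list \<Rightarrow> bool" where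
  "reduced_word A \<theta> w \<longleftrightarrow> w \<in> lists A \<and> (\<forall>a\<in>A. \<not> sublist [a, \<theta> a] w)"

text \<open>The reduced word representing the inverse, in the group \<open>G\<^sub>\<theta>\<close> generated by \<open>A\<close> with
  relations \<open>a \<theta>(a) = 1\<close>, of the element represented by a reduced word; this is justified by
  the lemmas below, in which \<open>group_eq A \<theta>\<close> is equality in \<open>G\<^sub>\<theta>\<close> (every generator has
  the generator \<open>\<theta>(a)\<close> as its inverse, so words in \<open>A\<close> suffice).\<close>

definition inverse_word :: "('a \<Rightarrow> 'a) \<Rightarrow> 'a list \<Rightarrow> 'a list" where
  "inverse_word \<theta> w = rev (map \<theta> w)"

inductive group_eq :: "'a set \<Rightarrow> ('a \<Rightarrow> 'a) \<Rightarrow> 'a list \<Rightarrow> 'a list \<Rightarrow> bool"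
  for A :: "'a set" and \<theta> :: "'a \<Rightarrow> 'a" where
  refl: "group_eq A \<theta> w w"
| sym: "group_eq A \<theta> v w \<Longrightarrow> group_eq A \<theta> w v"
| trans: "group_eq A \<theta> u v \<Longrightarrow> group_eq A \<theta> v w \<Longrightarrow> group_eq A \<theta> u w"
| cancel: "a \<in> A \<Longrightarrow> group_eq A \<theta> (u @ [a, \<theta> a] @ v) (u @ v)"

lemma group_eq_append_inverse_word:
  assumes "w \<in> lists A"
  shows "group_eq A \<theta> (w @ inverse_word \<theta> w) []"
  using assms
proof (induction w rule: rev_induct)
  case Nil
  then show ?case by (simp add: inverse_word_def group_eq.refl)
next
  case (snoc a w)
  have "group_eq A \<theta> (w @ [a, \<theta> a] @ inverse_word \<theta> w) (w @ inverse_word \<theta> w)"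
    using snoc.prems by (intro group_eq.cancel) auto
  with snoc show ?case
    by (auto simp: inverse_word_def intro: group_eq.trans)
qed

lemma inverse_word_inverse_word:
  assumes "involution_on A \<theta>" "w \<in> lists A"
  shows "inverse_word \<theta> (inverse_word \<theta> w) = w"
  using assms by (auto simp: inverse_word_def involution_on_def rev_map intro!: map_idI)

lemma reduced_word_inverse_word:
  assumes "involution_on A \<theta>" "reduced_word A \<theta> w"
  shows "reduced_word A \<theta> (inverse_word \<theta> w)"
proof -
  have w: "w \<in> lists A" using assms(2) by (simp add: reduced_word_def)
  have "\<not> sublist [a, \<theta> a] (inverse_word \<theta> w)" if "a \<in> A" for a
  proof
    assume "sublist [a, \<theta> a] (inverse_word \<theta> w)"
    then obtain ps ss where "inverse_word \<theta> w = ps @ [a, \<theta> a] @ ss"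
      by (auto simp: sublist_def)
    then have "w = inverse_word \<theta> (ps @ [a, \<theta> a] @ ss)"
      using inverse_word_inverse_word[OF assms(1) w] by simp
    then have "w = inverse_word \<theta> ss @ [a, \<theta> a] @ inverse_word \<theta> ps"
      using assms(1) that by (simp add: inverse_word_def involution_on_def)
    then have "sublist [a, \<theta> a] w" by (auto simp: sublist_def)
    with assms(2) that show False by (simp add: reduced_word_def)
  qed
  moreover have "inverse_word \<theta> w \<in> lists A"
    using assms(1) w by (auto simp: inverse_word_def involution_on_def)
  ultimately show ?thesis by (simp add: reduced_word_def)
qed

definition laminary_set :: "'a set \<Rightarrow> ('a \<Rightarrow> 'a) \<Rightarrow> 'a list set \<Rightarrow> bool" where
  "laminary_set A \<theta> S \<longleftrightarrow> involution_on A \<theta> \<and> biextendable A S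
     \<and> (\<forall>w\<in>S. reduced_word A \<theta> w) \<and> (\<forall>w\<in>S. inverse_word \<theta> w \<in> S)"

definition specular_set :: "'a set \<Rightarrow> ('a \<Rightarrow> 'a) \<Rightarrow> 'a list set \<Rightarrow> bool" where
  "specular_set A \<theta> S \<longleftrightarrow> laminary_set A \<theta> S \<and> tree_set A 2 S"


section \<open>Doubling transducers\<close>

datatype ('s, 'a) edge = Edge (source: nat) (inlabel: 's) (outlabel: 'a) (target: nat)

definition edge_from :: "('s, 'a) edge set \<Rightarrow> nat \<Rightarrow> 's \<Rightarrow> ('s, 'a) edge" where
  "edge_from E i \<alpha> = (THE e. e \<in> E \<and> source e = i \<and> inlabel e = \<alpha>)"

definition edge_with_output :: "('s, 'a) edge set \<Rightarrow> 'a \<Rightarrow> ('s, 'a) edge" where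
  "edge_with_output E a = (THE e. e \<in> E \<and> outlabel e = a)"

definition doubling_transducer :: "'s set \<Rightarrow> 'a set \<Rightarrow> ('s, 'a) edge set \<Rightarrow> bool" where
  "doubling_transducer \<Sigma> A E \<longleftrightarrow>
     (\<forall>e\<in>E. source e \<in> {0, 1} \<and> inlabel e \<in> \<Sigma> \<and> target e \<in> {0, 1})
     \<and> (\<forall>\<alpha>\<in>\<Sigma>. \<forall>i\<in>{0, 1}. \<exists>!e. e \<in> E \<and> source e = i \<and> inlabel e = \<alpha>)
     \<and> (\<forall>\<alpha>\<in>\<Sigma>. bij_betw (\<lambda>i. target (edge_from E i \<alpha>)) {0, 1} {0, 1})
     \<and> inj_on outlabel E
     \<and> A = outlabel ` E"

primrec doubling_map :: "('s, 'a) edge set \<Rightarrow> nat \<Rightarrow> 's list \<Rightarrow> 'a list" where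
  "doubling_map E i [] = []"
| "doubling_map E i (\<alpha> # u) =
     outlabel (edge_from E i \<alpha>) # doubling_map E (target (edge_from E i \<alpha>)) u"

definition doubling_involution :: "('s, 'a) edge set \<Rightarrow> 'a \<Rightarrow> 'a" where
  "doubling_involution E a =
     (let e = edge_with_output E a in outlabel (edge_from E (1 - target e) (inlabel e)))"

end

theory Submission
  imports Defs "Graph_Theory.Digraph_Isomorphism"
begin

text \<open>The extensions of \<open>\<delta>\<^sub>i(u)\<close> in \<open>S\<close> are the images of the extensions of \<open>u\<close> in \<open>T\<close>: reading
  backwards from the state \<open>i\<close> on the left, and forwards from the state reached by \<open>u\<close> on the
  right. As \<open>\<delta>\<^sub>i(u)\<close> determines \<open>u\<close>, and also \<open>i\<close> unless \<open>u\<close> is empty, the extension graph of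
  \<open>\<delta>\<^sub>i(u)\<close> is an isomorphic copy of that of \<open>u\<close>, except that the empty word gives two disjoint
  copies, one for each state. Since \<open>\<theta>\<close> maps the letter of an edge \<open>i \<rightarrow> j\<close> to that of an edge
  \<open>1 - j \<rightarrow> 1 - i\<close>, the inverse of \<open>\<delta>\<^sub>i(u)\<close> is the image of the reversal of \<open>u\<close>, and \<open>\<theta>(a)\<close>
  never follows \<open>a\<close>, since its edge starts at \<open>1 - j\<close> rather than at \<open>j\<close>.\<close>

section \<open>Isomorphic copies of undirected trees\<close>

definition graph_image :: "('v \<Rightarrow> 'w) \<Rightarrow> 'v pair_pre_digraph \<Rightarrow> 'w pair_pre_digraph" where
  "graph_image f G = \<lparr> pverts = f ` pverts G, parcs = map_prod f f ` parcs G \<rparr>"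

lemma graph_image_simps [simp]:
  "pverts (graph_image f G) = f ` pverts G"
  "parcs (graph_image f G) = map_prod f f ` parcs G"
  by (simp_all add: graph_image_def)

lemma pair_graph_graph_image:
  assumes "pair_graph G" "inj_on f (pverts G)"
  shows "pair_graph (graph_image f G)"
proof -
  interpret pair_graph G by fact
  have "\<And>u v. (u, v) \<in> parcs G \<Longrightarrow> f u \<noteq> f v"
    using assms(2) by (metis inj_on_eq_iff in_arcsD1 in_arcsD2 no_loops')
  moreover have "symmetric (with_proj (graph_image f G))"
    using pair_sym_arcs by (auto simp: symmetric_def sym_def)
  moreover have "finite (pverts G)" "finite (parcs G)"
    by (simp_all add: pair_finite_verts pair_finite_arcs)
  ultimately show ?thesis
    by unfold_locales (auto dest: in_arcsD1 in_arcsD2)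
qed

text \<open>Turned into a digraph isomorphism, \<open>f\<close> carries connectedness forward, while
  its inverse pulls every cycle of the image back to a cycle of \<open>G\<close> of the same
  length.\<close>

lemma undirected_tree_graph_image:
  assumes tree: "undirected_tree G" and inj: "inj_on f (pverts G)"
  shows "undirected_tree (graph_image f G)"
proof -
  interpret pair_graph G using tree by (simp add: undirected_tree_def)
  define hom where
    "hom = \<lparr> iso_verts = f, iso_arcs = map_prod f f, iso_head = snd, iso_tail = fst \<rparr>"
  have app: "app_iso hom (with_proj G) = with_proj (graph_image f G)"
    by (simp add: hom_def app_iso_def with_proj_def graph_image_def)
  have "inj_on (map_prod f f) (parcs G)"
  proof (rule inj_on_subset)
    show "inj_on (map_prod f f) (pverts G \<times> pverts G)"
      using inj inj by (rule map_prod_inj_on)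
  qed (auto dest: in_arcsD1 in_arcsD2)
  then have hom: "digraph_isomorphism hom"
    using inj wf_digraph by (auto simp: digraph_isomorphism_def hom_def)
  interpret H: wf_digraph "app_iso hom (with_proj G)" using hom ..
  have inv: "H.digraph_isomorphism (inv_iso hom)"
    using hom by (rule digraph_isomorphism_invI)
  have "\<exists>q. cycle q \<and> length q = length p" if "H.cycle p" for p
  proof -
    from that obtain u where walk: "H.awalk u p u"
      and dist: "distinct (tl (H.awalk_verts u p))" and "p \<noteq> []"
      by (auto simp: H.cycle_def)
    let ?u = "iso_verts (inv_iso hom) u" and ?q = "map (iso_arcs (inv_iso hom)) p"
    \<comment> \<open>The vertices of the pulled-back walk are the images of those of
      \<open>p\<close> under a map injective on them, so distinctness survives.\<close>
    have "pawalk_verts ?u ?q = map (iso_verts (inv_iso hom)) (H.awalk_verts u p)"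
      using H.awalk_verts_app_iso_eq[OF inv walk] hom by simp
    moreover have "inj_on (iso_verts (inv_iso hom)) (set (H.awalk_verts u p))"
      using H.digraph_isomorphism_inj_on_verts[OF inv] walk by (blast intro: inj_on_subset)
    moreover have "set (tl (H.awalk_verts u p)) \<subseteq> set (H.awalk_verts u p)"
      by (metis list.set_sel(2) list.sel(2) subsetI)
    ultimately have "distinct (tl (pawalk_verts ?u ?q))"
      using dist by (simp add: map_tl[symmetric] distinct_map inj_on_subset)
    with awalk_app_isoD[OF walk hom] \<open>p \<noteq> []\<close> have "cycle ?q"
      by (auto simp: cycle_def)
    then show ?thesis by (intro exI[of _ ?q]) simp
  qed
  then have "\<not> (\<exists>p. H.cycle p \<and> 3 \<le> length p)"
    using tree by (metis undirected_tree_def)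
  moreover have "Digraph_Component.connected (app_iso hom (with_proj G))"
    using tree hom by (auto simp: undirected_tree_def intro: connectedI_app_iso)
  moreover have "pair_graph (graph_image f G)"
    using pair_graph inj by (rule pair_graph_graph_image)
  ultimately show ?thesis by (simp add: undirected_tree_def app)
qed

text \<open>Connectedness in the graph library includes having a vertex.\<close>

lemma undirected_tree_nonempty:
  assumes "undirected_tree G"
  shows "pverts G \<noteq> {}"
  using assms
  by (auto simp: undirected_tree_def Digraph_Component.connected_def strongly_connected_def
      mk_symmetric_def)

lemma inj_on_map_sum:
  assumes "inj_on f A" "inj_on g B"
  shows "inj_on (map_sum f g) (A <+> B)"
  using assms by (auto intro!: inj_onI dest: inj_onD)

section \<open>Disjoint unions of one and of two trees\<close>

lemma disjoint_union_of_trees_1: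
  assumes "disjoint_union_of_trees 1 G"
  shows "undirected_tree G"
proof -
  from assms obtain F where "card F = 1" "\<forall>H\<in>F. undirected_tree H"
    "pverts G = (\<Union>H\<in>F. pverts H)" "parcs G = (\<Union>H\<in>F. parcs H)"
    by (auto simp: disjoint_union_of_trees_def)
  then show ?thesis by (auto simp: card_1_singleton_iff)
qed

lemma disjoint_union_of_trees_2:
  assumes "undirected_tree H" "undirected_tree K" "disjnt (pverts H) (pverts K)"
    and "pverts G = pverts H \<union> pverts K" "parcs G = parcs H \<union> parcs K"
  shows "disjoint_union_of_trees 2 G"
proof -
  \<comment> \<open>Equal graphs with disjoint vertex sets would have no vertices; hence
    \<open>{H, K}\<close> really has cardinality 2.\<close>
  have "H \<noteq> K" using assms(1,3) undirected_tree_nonempty by (auto simp: disjnt_def)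
  then show ?thesis
    unfolding disjoint_union_of_trees_def using assms
    by (intro exI[of _ "{H, K}"]) (auto simp: pairwise_def disjnt_sym)
qed


section \<open>Doubling transducers\<close>

locale doubling =
  fixes \<Sigma> :: "'s set" and A :: "'a set" and E :: "('s, 'a) edge set"
  assumes transducer: "doubling_transducer \<Sigma> A E"
begin

abbreviation next_state :: "nat \<Rightarrow> 's \<Rightarrow> nat" where
  "next_state i \<alpha> \<equiv> target (edge_from E i \<alpha>)"

abbreviation label :: "nat \<Rightarrow> 's \<Rightarrow> 'a" where
  "label i \<alpha> \<equiv> outlabel (edge_from E i \<alpha>)"

abbreviation \<delta> :: "nat \<Rightarrow> 's list \<Rightarrow> 'a list" where
  "\<delta> \<equiv> doubling_map E"

abbreviation \<theta> :: "'a \<Rightarrow> 'a" where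
  "\<theta> \<equiv> doubling_involution E"

section \<open>Action of words on the two states\<close>

definition end_state :: "nat \<Rightarrow> 's list \<Rightarrow> nat" where
  "end_state i u = fold (\<lambda>\<alpha> i. next_state i \<alpha>) u i"

lemma end_state_simps [simp]:
  "end_state i [] = i"
  "end_state i (\<alpha> # u) = end_state (next_state i \<alpha>) u"
  "end_state i (u @ v) = end_state (end_state i u) v"
  by (simp_all add: end_state_def)

lemma edge_from:
  assumes "\<alpha> \<in> \<Sigma>" "i \<in> {0, 1}"
  shows "edge_from E i \<alpha> \<in> E" "source (edge_from E i \<alpha>) = i" "inlabel (edge_from E i \<alpha>) = \<alpha>"
proof -
  have "\<exists>!e. e \<in> E \<and> source e = i \<and> inlabel e = \<alpha>"
    using transducer assms unfolding doubling_transducer_def by blast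
  from theI'[OF this] show "edge_from E i \<alpha> \<in> E" "source (edge_from E i \<alpha>) = i"
    "inlabel (edge_from E i \<alpha>) = \<alpha>"
    by (simp_all add: edge_from_def)
qed

lemma edge_from_source_inlabel:
  assumes "e \<in> E"
  shows "edge_from E (source e) (inlabel e) = e"
proof -
  have "source e \<in> {0, 1}" "inlabel e \<in> \<Sigma>"
    using transducer assms by (auto simp: doubling_transducer_def)
  then have "\<exists>!e'. e' \<in> E \<and> source e' = source e \<and> inlabel e' = inlabel e"
    using transducer unfolding doubling_transducer_def by blast
  then show ?thesis
    unfolding edge_from_def using assms by (blast intro: the1_equality)
qed

lemma next_state_in:
  assumes "\<alpha> \<in> \<Sigma>" "i \<in> {0, 1}"
  shows "next_state i \<alpha> \<in> {0, 1}"
  using transducer edge_from(1)[OF assms] by (auto simp: doubling_transducer_def)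

text \<open>The only permutations of two states are the identity and the swap, and both commute with
  \<open>i \<mapsto> 1 - i\<close>. Truncated subtraction is harmless on
  \<open>{0, 1}\<close>.\<close>

lemma next_state_complement:
  assumes "\<alpha> \<in> \<Sigma>" "i \<in> {0, 1}"
  shows "next_state (1 - i) \<alpha> = 1 - next_state i \<alpha>"
proof -
  have "inj_on (\<lambda>i. next_state i \<alpha>) {0, 1}"
    using transducer assms by (auto simp: doubling_transducer_def bij_betw_def)
  then have "next_state 0 \<alpha> \<noteq> next_state 1 \<alpha>" by (auto simp: inj_on_def)
  with next_state_in[OF assms(1), of 0] next_state_in[OF assms(1), of 1] assms(2)
  show ?thesis by auto
qed

text \<open>A permutation of two states is its own inverse, so that \<^term>\<open>next_state\<close> also walks
  backwards along an edge.\<close>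

lemma next_state_next_state:
  assumes "\<alpha> \<in> \<Sigma>" "i \<in> {0, 1}"
  shows "next_state (next_state i \<alpha>) \<alpha> = i"
  using next_state_in[OF assms] next_state_complement[OF assms] assms(2) by auto

lemma end_state_in:
  assumes "u \<in> lists \<Sigma>" "i \<in> {0, 1}"
  shows "end_state i u \<in> {0, 1}"
  using assms
proof (induction u arbitrary: i)
  case (Cons \<alpha> u)
  then show ?case using next_state_in[of \<alpha> i] by (metis Cons_in_lists_iff end_state_simps(2))
qed simp

lemma end_state_complement:
  assumes "u \<in> lists \<Sigma>" "i \<in> {0, 1}"
  shows "end_state (1 - i) u = 1 - end_state i u"
  using assms
proof (induction u arbitrary: i)
  case (Cons \<alpha> u)
  then show ?case
    using next_state_in[of \<alpha> i] next_state_complement[of \<alpha> i]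
    by (metis Cons_in_lists_iff end_state_simps(2))
qed simp

text \<open>Each letter undoes itself, so reading \<open>rev u\<close> from the end of a path
  retraces it to its start.\<close>

lemma end_state_rev:
  assumes "u \<in> lists \<Sigma>" "i \<in> {0, 1}"
  shows "end_state (end_state i u) (rev u) = i"
  using assms
proof (induction u arbitrary: i)
  case (Cons \<alpha> u)
  then show ?case
    using next_state_in[of \<alpha> i] next_state_next_state[of \<alpha> i] by simp
qed simp

section \<open>Output letters and the involution\<close>

lemma label_in:
  assumes "\<alpha> \<in> \<Sigma>" "i \<in> {0, 1}"
  shows "label i \<alpha> \<in> A"
  using transducer edge_from(1)[OF assms] by (auto simp: doubling_transducer_def)

lemma label_eq_iff:
  assumes "\<alpha> \<in> \<Sigma>" "i \<in> {0, 1}" "\<beta> \<in> \<Sigma>" "j \<in> {0, 1}"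
  shows "label i \<alpha> = label j \<beta> \<longleftrightarrow> i = j \<and> \<alpha> = \<beta>"
proof
  assume "label i \<alpha> = label j \<beta>"
  then have "edge_from E i \<alpha> = edge_from E j \<beta>"
    using transducer edge_from(1) assms by (auto simp: doubling_transducer_def inj_on_def)
  then show "i = j \<and> \<alpha> = \<beta>" using edge_from(2,3) assms by metis
qed simp

lemma label_cases:
  assumes "a \<in> A"
  obtains i \<alpha> where "i \<in> {0, 1}" "\<alpha> \<in> \<Sigma>" "a = label i \<alpha>"
proof -
  from assms transducer obtain e where "e \<in> E" "a = outlabel e"
    by (auto simp: doubling_transducer_def)
  then show thesis
    using that[of "source e" "inlabel e"] transducer edge_from_source_inlabel[of e]
    by (simp add: doubling_transducer_def)
qed

lemma finite_output:
  assumes "finite \<Sigma>"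
  shows "finite A"
proof (rule finite_subset)
  show "A \<subseteq> (\<lambda>(i, \<alpha>). label i \<alpha>) ` ({0, 1} \<times> \<Sigma>)"
    by (force elim: label_cases)
qed (use assms in simp)

lemma involution_label:
  assumes "\<alpha> \<in> \<Sigma>" "i \<in> {0, 1}"
  shows "\<theta> (label i \<alpha>) = label (1 - next_state i \<alpha>) \<alpha>"
proof -
  have "edge_with_output E (label i \<alpha>) = edge_from E i \<alpha>"
    unfolding edge_with_output_def using edge_from(1)[OF assms] transducer
    by (auto simp: doubling_transducer_def inj_on_def)
  then show ?thesis using edge_from(3)[OF assms] by (simp add: doubling_involution_def)
qed

lemma involution_on_output: "involution_on A \<theta>"
  unfolding involution_on_def
proof
  fix a assume "a \<in> A"
  then obtain i \<alpha> where i: "i \<in> {0, 1}" and \<alpha>: "\<alpha> \<in> \<Sigma>" and a: "a = label i \<alpha>"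
    by (rule label_cases)
  let ?j = "next_state i \<alpha>"
  have j: "?j \<in> {0, 1}" using next_state_in[OF \<alpha> i] .
  then have j': "1 - ?j \<in> {0, 1}" by auto
  have "\<theta> (\<theta> a) = label (1 - next_state (1 - ?j) \<alpha>) \<alpha>"
    using involution_label \<alpha> i j' a by simp
  \<comment> \<open>The partner of the edge from \<open>i\<close> to \<open>?j\<close> runs from
    \<open>1 - ?j\<close> to \<open>1 - i\<close>; complementing its end gives \<open>i\<close>
    back.\<close>
  also have "1 - next_state (1 - ?j) \<alpha> = i"
    using next_state_complement[OF \<alpha> j] next_state_next_state[OF \<alpha> i] i by auto
  finally show "\<theta> a \<in> A \<and> \<theta> (\<theta> a) = a"
    using involution_label[OF \<alpha> i] label_in[OF \<alpha> j'] a by simp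
qed

section \<open>The doubling map on words\<close>

lemma length_doubling_map [simp]: "length (\<delta> i u) = length u"
  by (induction u arbitrary: i) simp_all

lemma doubling_map_append: "\<delta> i (u @ v) = \<delta> i u @ \<delta> (end_state i u) v"
  by (induction u arbitrary: i) simp_all

text \<open>The map is letter-to-letter, so a cut of the output is a cut of the input at the same
  position; the second piece is read from the state reached by the first.\<close>

lemma doubling_map_eq_append_conv:
  "\<delta> i w = x @ y \<longleftrightarrow> (\<exists>u v. w = u @ v \<and> x = \<delta> i u \<and> y = \<delta> (end_state i u) v)"
proof
  assume w: "\<delta> i w = x @ y"
  let ?u = "take (length x) w" and ?v = "drop (length x) w"
  have len: "length w = length x + length y"
    using arg_cong[OF w, of length] by simp
  have "x @ y = \<delta> i ?u @ \<delta> (end_state i ?u) ?v"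
    using w doubling_map_append[of i ?u ?v] by simp
  moreover have "length x = length (\<delta> i ?u)" by (simp add: len)
  ultimately have "x = \<delta> i ?u \<and> y = \<delta> (end_state i ?u) ?v"
    using append_eq_append_conv by blast
  then show "\<exists>u v. w = u @ v \<and> x = \<delta> i u \<and> y = \<delta> (end_state i u) v"
    by (metis append_take_drop_id)
qed (auto simp: doubling_map_append)

lemma doubling_map_in_lists:
  assumes "u \<in> lists \<Sigma>" "i \<in> {0, 1}"
  shows "\<delta> i u \<in> lists A"
  using assms
proof (induction u arbitrary: i)
  case (Cons \<alpha> u)
  then show ?case using next_state_in[of \<alpha> i] label_in[of \<alpha> i] by simp
qed simp

text \<open>The first output letter reveals the starting state and the first input letter, hence
  also the next state, from which the induction continues. Only the empty word forgets its
  state.\<close>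

lemma doubling_map_eq_iff:
  assumes "u \<in> lists \<Sigma>" "i \<in> {0, 1}" "v \<in> lists \<Sigma>" "j \<in> {0, 1}"
  shows "\<delta> i u = \<delta> j v \<longleftrightarrow> u = v \<and> (u = [] \<or> i = j)"
proof
  show "\<delta> i u = \<delta> j v \<Longrightarrow> u = v \<and> (u = [] \<or> i = j)"
    using assms
  proof (induction u arbitrary: i j v)
    case Nil
    then have "length v = 0" by (metis length_doubling_map list.size(3))
    then show ?case by simp
  next
    case (Cons \<alpha> u)
    then obtain \<beta> v' where v: "v = \<beta> # v'" by (cases v) auto
    with Cons have "i = j" "\<alpha> = \<beta>" using label_eq_iff[of \<alpha> i \<beta> j] by auto
    then show ?case
      using Cons.prems Cons.hyps v next_state_in[of \<alpha> i] Cons.IH[of "next_state i \<alpha>" "next_state i \<alpha>" v']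
      by simp
  qed
qed auto

text \<open>Reversing a path and complementing its states turns each edge
  \<open>i \<rightarrow> j\<close> into \<open>1 - j \<rightarrow> 1 - i\<close> with the same
  input, which is the effect of \<open>\<theta>\<close>; the new path starts at the complement of
  the old end.\<close>

lemma inverse_word_doubling_map:
  assumes "u \<in> lists \<Sigma>" "i \<in> {0, 1}"
  shows "inverse_word \<theta> (\<delta> i u) = \<delta> (1 - end_state i u) (rev u)"
  using assms
proof (induction u arbitrary: i)
  case Nil
  then show ?case by (simp add: inverse_word_def)
next
  case (Cons \<alpha> u)
  let ?k = "next_state i \<alpha>"
  have \<alpha>: "\<alpha> \<in> \<Sigma>" and u: "u \<in> lists \<Sigma>" using Cons.hyps by auto
  have k: "?k \<in> {0, 1}" using next_state_in[OF \<alpha> Cons.prems] .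
  have "rev u \<in> lists \<Sigma>" using u by auto
  from end_state_complement[OF this end_state_in[OF u k]]
  have "end_state (1 - end_state ?k u) (rev u) = 1 - ?k"
    using end_state_rev[OF u k] by simp
  then show ?case
    using Cons.IH[OF k] involution_label[OF \<alpha> Cons.prems]
    by (simp add: inverse_word_def doubling_map_append)
qed

lemma reduced_word_doubling_map:
  assumes u: "u \<in> lists \<Sigma>" and i: "i \<in> {0, 1}"
  shows "reduced_word A \<theta> (\<delta> i u)"
proof -
  have False if "sublist [a, \<theta> a] (\<delta> i u)" for a
  proof -
    from that obtain x y where "\<delta> i u = x @ [a, \<theta> a] @ y" by (auto simp: sublist_def)
    then obtain p v where uv: "u = p @ v" and v: "\<delta> (end_state i p) v = [a, \<theta> a] @ y"
      by (metis doubling_map_eq_append_conv)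
    let ?k = "end_state i p"
    from v have "2 \<le> length v" by (metis length_doubling_map length_append le_add1 length_Cons
        list.size(3) numeral_2_eq_2)
    then obtain \<alpha> \<beta> v' where v': "v = \<alpha> # \<beta> # v'"
      by (metis Suc_le_length_iff numeral_2_eq_2)
    have k: "?k \<in> {0, 1}" and \<alpha>: "\<alpha> \<in> \<Sigma>" and \<beta>: "\<beta> \<in> \<Sigma>"
      using u i uv v' end_state_in[of p i] by auto
    have j: "next_state ?k \<alpha> \<in> {0, 1}" using next_state_in[OF \<alpha> k] .
    \<comment> \<open>Both sides are \<open>\<theta> a\<close>: the left by the formula for the
      involution, the right as the output following \<open>a\<close>. Their source states are
      complementary, so they cannot agree.\<close>
    have "label (1 - next_state ?k \<alpha>) \<alpha> = label (next_state ?k \<alpha>) \<beta>"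
      using v v' involution_label[OF \<alpha> k] by auto
    then show False
      using label_eq_iff[of \<alpha> "1 - next_state ?k \<alpha>" \<beta> "next_state ?k \<alpha>"] \<alpha> \<beta> j by auto
  qed
  then show ?thesis
    using doubling_map_in_lists[OF u i] by (auto simp: reduced_word_def)
qed


section \<open>Extensions in the image of a set of words\<close>

definition image_set :: "'s list set \<Rightarrow> 'a list set" where
  "image_set T = \<delta> 0 ` T \<union> \<delta> 1 ` T"

lemma in_image_set_iff: "w \<in> image_set T \<longleftrightarrow> (\<exists>i\<in>{0, 1}. \<exists>u\<in>T. w = \<delta> i u)"
  by (auto simp: image_set_def)

text \<open>The states from which \<open>u\<close> can be read with output \<open>\<delta>\<^sub>i(u)\<close>.\<close>

definition occurrence_states :: "nat \<Rightarrow> 's list \<Rightarrow> nat set" where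
  "occurrence_states i u = (if u = [] then {0, 1} else {i})"

text \<open>Common source of the three extension formulas. Here \<open>k\<close> is the state in
  which the middle factor \<open>u\<close> starts, so the whole path begins at the state found by
  reading \<open>p\<close> backwards from \<open>k\<close>.\<close>

lemma append_in_image_set_iff:
  assumes T: "T \<subseteq> lists \<Sigma>" and u: "u \<in> lists \<Sigma>" and i: "i \<in> {0, 1}"
  shows "x @ \<delta> i u @ y \<in> image_set T \<longleftrightarrow>
    (\<exists>k\<in>occurrence_states i u. \<exists>p q. p @ u @ q \<in> T
      \<and> x = \<delta> (end_state k (rev p)) p \<and> y = \<delta> (end_state k u) q)"
    (is "?L \<longleftrightarrow> ?R")
proof
  assume ?L
  then obtain m w where m: "m \<in> {0, 1}" and w: "w \<in> T" "\<delta> m w = x @ \<delta> i u @ y"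
    by (metis in_image_set_iff)
  then obtain p v q where pvq: "w = p @ v @ q" and x: "x = \<delta> m p"
    and v: "\<delta> i u = \<delta> (end_state m p) v" and y: "y = \<delta> (end_state (end_state m p) v) q"
    by (metis doubling_map_eq_append_conv)
  let ?k = "end_state m p"
  have lists: "p \<in> lists \<Sigma>" "v \<in> lists \<Sigma>" using T w(1) pvq by auto
  have k: "?k \<in> {0, 1}" using end_state_in[OF lists(1) m] .
  have "u = v" "?k \<in> occurrence_states i u"
    using v doubling_map_eq_iff[OF u i lists(2) k] k by (auto simp: occurrence_states_def)
  moreover have "end_state ?k (rev p) = m" using end_state_rev[OF lists(1) m] .
  ultimately show ?R using pvq w(1) x y by (intro bexI[of _ ?k] exI[of _ p] exI[of _ q]) auto
next
  assume ?R
  then obtain k p q where k: "k \<in> occurrence_states i u" and w: "p @ u @ q \<in> T"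
    and xy: "x = \<delta> (end_state k (rev p)) p" "y = \<delta> (end_state k u) q" by blast
  have k01: "k \<in> {0, 1}" and "\<delta> i u = \<delta> k u"
    using k i by (auto simp: occurrence_states_def split: if_splits)
  moreover have p: "rev p \<in> lists \<Sigma>" using T w by auto
  ultimately have "\<delta> (end_state k (rev p)) (p @ u @ q) = x @ \<delta> i u @ y"
    using xy end_state_rev[OF p k01] by (simp add: doubling_map_append)
  then show ?L
    using w end_state_in[OF p k01] by (metis in_image_set_iff)
qed

lemma doubling_map_eq_singleton_iff: "[a] = \<delta> i u \<longleftrightarrow> (\<exists>\<alpha>. u = [\<alpha>] \<and> a = label i \<alpha>)"
  by (cases u; cases "tl u") auto

text \<open>For \<open>u = [\<alpha>]\<close> the state \<open>end_state i (rev u)\<close> is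
  \<open>next_state i \<alpha>\<close>, the source of the edge that enters \<open>i\<close> with
  input \<open>\<alpha>\<close>.\<close>

lemma doubling_map_eq_singleton_rev_iff:
  "[a] = \<delta> (end_state i (rev u)) u \<longleftrightarrow> (\<exists>\<alpha>. u = [\<alpha>] \<and> a = label (next_state i \<alpha>) \<alpha>)"
  by (cases u; cases "tl u") auto

lemma doubling_map_eq_Nil_iff: "[] = \<delta> i u \<longleftrightarrow> u = []"
  by (cases u) auto

lemma occurrence_states_subset: "i \<in> {0, 1} \<Longrightarrow> occurrence_states i u \<subseteq> {0, 1}"
  by (auto simp: occurrence_states_def)

context
  fixes T :: "'s list set" and u :: "'s list" and i :: nat
  assumes T: "T \<subseteq> lists \<Sigma>" and u: "u \<in> lists \<Sigma>" and i: "i \<in> {0, 1}"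
begin

lemma backward_label_in:
  assumes "k \<in> occurrence_states i u" "\<alpha> \<in> \<Sigma>"
  shows "label (next_state k \<alpha>) \<alpha> \<in> A"
proof -
  have "k \<in> {0, 1}" using occurrence_states_subset[OF i] assms(1) by blast
  then show ?thesis by (intro label_in next_state_in assms(2))
qed

lemma forward_label_in:
  assumes "k \<in> occurrence_states i u" "\<alpha> \<in> \<Sigma>"
  shows "label (end_state k u) \<alpha> \<in> A"
proof -
  have "k \<in> {0, 1}" using occurrence_states_subset[OF i] assms(1) by blast
  then show ?thesis by (intro label_in end_state_in assms(2) u)
qed

lemma left_ext_image_set:
  "left_ext A (image_set T) (\<delta> i u) =
    (\<Union>k\<in>occurrence_states i u. (\<lambda>\<alpha>. label (next_state k \<alpha>) \<alpha>) ` left_ext \<Sigma> T u)"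
proof -
  have "a # \<delta> i u \<in> image_set T \<longleftrightarrow> (\<exists>k\<in>occurrence_states i u. \<exists>\<alpha>. \<alpha> # u \<in> T
      \<and> a = label (next_state k \<alpha>) \<alpha>)" for a
    using append_in_image_set_iff[OF T u i, of "[a]" "[]"]
    by (simp add: doubling_map_eq_singleton_rev_iff doubling_map_eq_Nil_iff)
      (metis append_Cons append_Nil)
  moreover have "\<alpha> \<in> \<Sigma>" if "\<alpha> # u \<in> T" for \<alpha> using T that by auto
  ultimately show ?thesis
    by (auto simp: left_ext_def intro: backward_label_in)
qed

lemma right_ext_image_set:
  "right_ext A (image_set T) (\<delta> i u) =
    (\<Union>k\<in>occurrence_states i u. label (end_state k u) ` right_ext \<Sigma> T u)"
proof -
  have "\<delta> i u @ [b] \<in> image_set T \<longleftrightarrow> (\<exists>k\<in>occurrence_states i u. \<exists>\<beta>. u @ [\<beta>] \<in> T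
      \<and> b = label (end_state k u) \<beta>)" for b
    using append_in_image_set_iff[OF T u i, of "[]" "[b]"]
    by (simp add: doubling_map_eq_singleton_iff doubling_map_eq_Nil_iff) metis
  moreover have "\<beta> \<in> \<Sigma>" if "u @ [\<beta>] \<in> T" for \<beta> using T that by auto
  ultimately show ?thesis
    by (auto simp: right_ext_def intro: forward_label_in)
qed

text \<open>Both letters are read around the same occurrence of \<open>u\<close>, so each pair comes
  from one state, as needed to split the graph into copies.\<close>

lemma bi_ext_image_set:
  "bi_ext A (image_set T) (\<delta> i u) =
    (\<Union>k\<in>occurrence_states i u.
      map_prod (\<lambda>\<alpha>. label (next_state k \<alpha>) \<alpha>) (label (end_state k u)) ` bi_ext \<Sigma> T u)"
proof -
  have "a # \<delta> i u @ [b] \<in> image_set T \<longleftrightarrow> (\<exists>k\<in>occurrence_states i u. \<exists>\<alpha> \<beta>. \<alpha> # u @ [\<beta>] \<in> T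
      \<and> a = label (next_state k \<alpha>) \<alpha> \<and> b = label (end_state k u) \<beta>)" (is "?L \<longleftrightarrow> ?R") for a b
  proof -
    have "?L \<longleftrightarrow> (\<exists>k\<in>occurrence_states i u. \<exists>p q. p @ u @ q \<in> T
        \<and> (\<exists>\<alpha>. p = [\<alpha>] \<and> a = label (next_state k \<alpha>) \<alpha>)
        \<and> (\<exists>\<beta>. q = [\<beta>] \<and> b = label (end_state k u) \<beta>))"
      \<comment> \<open>The backward rule is unfolded first, because the forward one, stated for an
        arbitrary state, would also match the condition on \<open>p\<close>.\<close>
      using append_in_image_set_iff[OF T u i, of "[a]" "[b]",
          unfolded doubling_map_eq_singleton_rev_iff, unfolded doubling_map_eq_singleton_iff]
      by simp
    also have "\<dots> \<longleftrightarrow> ?R"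
      by (rule bex_cong[OF HOL.refl]) (metis append_Cons append_Nil)
    finally show ?thesis .
  qed
  moreover have "\<alpha> \<in> \<Sigma> \<and> \<beta> \<in> \<Sigma>" if "\<alpha> # u @ [\<beta>] \<in> T" for \<alpha> \<beta> using T that by auto
  ultimately show ?thesis
    by (fastforce simp: bi_ext_def intro: backward_label_in forward_label_in)
qed

end

text \<open>The extension graph of \<open>u\<close> as seen when \<open>u\<close> is read from
  \<open>k\<close>: left vertices become outputs of edges entering \<open>k\<close>, right vertices
  outputs of edges leaving the state reached.\<close>

definition extension_copy :: "'s list set \<Rightarrow> nat \<Rightarrow> 's list \<Rightarrow> ('a + 'a) pair_pre_digraph" where
  "extension_copy T k u = graph_image
     (map_sum (\<lambda>\<alpha>. label (next_state k \<alpha>) \<alpha>) (label (end_state k u))) (extension_graph \<Sigma> T u)"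

text \<open>One copy for each occurrence state: a single one for nonempty \<open>u\<close>, two for
  the empty word, which is where characteristic 2 comes from.\<close>

lemma pverts_extension_graph_image_set:
  assumes "T \<subseteq> lists \<Sigma>" "u \<in> lists \<Sigma>" "i \<in> {0, 1}"
  shows "pverts (extension_graph A (image_set T) (\<delta> i u)) =
    (\<Union>k\<in>occurrence_states i u. pverts (extension_copy T k u))"
  by (simp add: extension_graph_def extension_copy_def left_ext_image_set[OF assms]
      right_ext_image_set[OF assms] Plus_def image_Un image_UN image_image UN_Un_distrib)

lemma parcs_extension_graph_image_set:
  assumes "T \<subseteq> lists \<Sigma>" "u \<in> lists \<Sigma>" "i \<in> {0, 1}"
  shows "parcs (extension_graph A (image_set T) (\<delta> i u)) =
    (\<Union>k\<in>occurrence_states i u. parcs (extension_copy T k u))"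
proof -
  have "parcs (extension_copy T k u) = (\<Union>(\<alpha>, \<beta>)\<in>bi_ext \<Sigma> T u.
      {(Inl (label (next_state k \<alpha>) \<alpha>), Inr (label (end_state k u) \<beta>)),
       (Inr (label (end_state k u) \<beta>), Inl (label (next_state k \<alpha>) \<alpha>))})" for k
    by (simp add: extension_graph_def extension_copy_def image_UN case_prod_beta)
  then show ?thesis
    by (simp add: extension_graph_def bi_ext_image_set[OF assms] case_prod_beta)
qed

text \<open>Labels determine input letters even though \<open>next_state k \<alpha>\<close> may vary
  with \<open>\<alpha>\<close>, so the relabelling is injective on each side, and the sum type keeps
  the sides apart.\<close>

lemma undirected_tree_extension_copy:
  assumes tree: "undirected_tree (extension_graph \<Sigma> T u)"
    and u: "u \<in> lists \<Sigma>" and k: "k \<in> {0, 1}"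
  shows "undirected_tree (extension_copy T k u)"
  unfolding extension_copy_def using tree
proof (rule undirected_tree_graph_image)
  have "inj_on (\<lambda>\<alpha>. label (next_state k \<alpha>) \<alpha>) \<Sigma>"
    using label_eq_iff[OF _ next_state_in[OF _ k] _ next_state_in[OF _ k]] by (simp add: inj_on_def)
  moreover have "inj_on (label (end_state k u)) \<Sigma>"
    using label_eq_iff[OF _ end_state_in[OF u k] _ end_state_in[OF u k]] by (simp add: inj_on_def)
  ultimately have "inj_on (map_sum (\<lambda>\<alpha>. label (next_state k \<alpha>) \<alpha>) (label (end_state k u)))
      (\<Sigma> <+> \<Sigma>)"
    by (rule inj_on_map_sum)
  then show "inj_on (map_sum (\<lambda>\<alpha>. label (next_state k \<alpha>) \<alpha>) (label (end_state k u)))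
      (pverts (extension_graph \<Sigma> T u))"
    by (rule inj_on_subset) (auto simp: extension_graph_def left_ext_def right_ext_def)
qed

text \<open>Equal labels would force equal letters and equal sources. On the right the sources are 0
  and 1; on the left they are the images of 0 and 1 under one letter, which acts as a
  permutation.\<close>

lemma disjnt_extension_copies:
  "disjnt (pverts (extension_copy T 0 [])) (pverts (extension_copy T 1 []))"
proof -
  have "label (next_state 0 \<alpha>) \<alpha> \<noteq> label (next_state 1 \<beta>) \<beta>" if "\<alpha> \<in> \<Sigma>" "\<beta> \<in> \<Sigma>" for \<alpha> \<beta>
  proof
    assume "label (next_state 0 \<alpha>) \<alpha> = label (next_state 1 \<beta>) \<beta>"
    then have "next_state 0 \<alpha> = next_state 1 \<beta> \<and> \<alpha> = \<beta>"
      using label_eq_iff[OF that(1) next_state_in[OF that(1), of 0]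
          that(2) next_state_in[OF that(2), of 1]] by blast
    then have "next_state 0 \<alpha> = next_state 1 \<alpha>" by blast
    then show False
      using next_state_next_state[OF that(1), of 0] next_state_next_state[OF that(1), of 1] by simp
  qed
  moreover have "label 0 \<alpha> \<noteq> label 1 \<beta>" if "\<alpha> \<in> \<Sigma>" "\<beta> \<in> \<Sigma>" for \<alpha> \<beta>
    using that label_eq_iff[of \<alpha> 0 \<beta> 1] by simp
  ultimately show ?thesis
    by (auto simp: disjnt_iff extension_copy_def extension_graph_def left_ext_def right_ext_def)
qed

section \<open>The image as a biextendable, tree and laminary set\<close>

lemma biextendable_image_set:
  assumes "biextendable \<Sigma> T"
  shows "biextendable A (image_set T)"
proof -
  have \<Sigma>: "finite \<Sigma>" and T: "T \<subseteq> lists \<Sigma>" and letters: "\<And>\<alpha>. \<alpha> \<in> \<Sigma> \<Longrightarrow> [\<alpha>] \<in> T"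
    and factors: "\<And>w u. w \<in> T \<Longrightarrow> sublist u w \<Longrightarrow> u \<in> T"
    and ext: "\<And>w. w \<in> T \<Longrightarrow> bi_ext \<Sigma> T w \<noteq> {}"
    using assms unfolding biextendable_def factorial_set_def by blast+
  have "image_set T \<subseteq> lists A"
    using T doubling_map_in_lists by (metis in_image_set_iff subset_iff)
  moreover have "[a] \<in> image_set T" if "a \<in> A" for a
  proof -
    from that obtain i \<alpha> where "i \<in> {0, 1}" "\<alpha> \<in> \<Sigma>" "a = label i \<alpha>" by (rule label_cases)
    then show ?thesis
      using letters by (auto simp: in_image_set_iff doubling_map_eq_singleton_iff)
  qed
  moreover have "x \<in> image_set T" if w: "w \<in> image_set T" and sub: "sublist x w" for w x
  proof -
    from w obtain i v where i: "i \<in> {0, 1}" and v: "v \<in> T" "w = \<delta> i v"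
      by (auto simp: in_image_set_iff)
    moreover obtain y z where "w = y @ x @ z" using sub by (auto simp: sublist_def)
    \<comment> \<open>The factor is read from the state reached by the prefix \<open>p\<close>,
      which may differ from \<open>i\<close>; hence the outputs from both states belong to the
      image.\<close>
    ultimately obtain p u q where pq: "v = p @ u @ q" and x: "x = \<delta> (end_state i p) u"
      by (metis doubling_map_eq_append_conv)
    have "p \<in> lists \<Sigma>" using T v(1) pq by auto
    moreover have "u \<in> T" using factors[OF v(1)] pq by (auto simp: sublist_def)
    ultimately show ?thesis using x end_state_in[OF _ i] by (metis in_image_set_iff)
  qed
  moreover have "bi_ext A (image_set T) w \<noteq> {}" if "w \<in> image_set T" for w
  proof -
    from that obtain i v where i: "i \<in> {0, 1}" and v: "v \<in> T" "w = \<delta> i v"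
      by (auto simp: in_image_set_iff)
    have "v \<in> lists \<Sigma>" using T v(1) by blast
    moreover have "occurrence_states i v \<noteq> {}" by (simp add: occurrence_states_def)
    ultimately show ?thesis
      using bi_ext_image_set[OF T _ i, of v] ext[OF v(1)] v(2) by simp
  qed
  ultimately show ?thesis
    using finite_output[OF \<Sigma>] by (simp add: biextendable_def factorial_set_def)
qed

lemma tree_set_image_set:
  assumes "tree_set \<Sigma> 1 T"
  shows "tree_set A 2 (image_set T)"
proof -
  have bi: "biextendable \<Sigma> T"
    and trees: "\<And>u. u \<in> T \<Longrightarrow> u \<noteq> [] \<Longrightarrow> undirected_tree (extension_graph \<Sigma> T u)"
    and "disjoint_union_of_trees 1 (extension_graph \<Sigma> T [])"
    using assms by (simp_all add: tree_set_def)
  from this(3) have tree: "undirected_tree (extension_graph \<Sigma> T [])"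
    by (rule disjoint_union_of_trees_1)
  have T: "T \<subseteq> lists \<Sigma>" using bi by (simp add: biextendable_def factorial_set_def)
  have "undirected_tree (extension_graph A (image_set T) w)"
    if w: "w \<in> image_set T" and "w \<noteq> []" for w
  proof -
    from w obtain i u where i: "i \<in> {0, 1}" and u: "u \<in> T" "w = \<delta> i u"
      by (auto simp: in_image_set_iff)
    with \<open>w \<noteq> []\<close> have "u \<noteq> []" by auto
    have "u \<in> lists \<Sigma>" using T u(1) by blast
    from pverts_extension_graph_image_set[OF T this i] parcs_extension_graph_image_set[OF T this i]
    have "extension_graph A (image_set T) w = extension_copy T i u"
      using \<open>u \<noteq> []\<close> u(2) by (simp add: occurrence_states_def)
    then show ?thesis
      using undirected_tree_extension_copy[OF trees[OF u(1) \<open>u \<noteq> []\<close>] \<open>u \<in> lists \<Sigma>\<close> i] by simp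
  qed
  moreover have "disjoint_union_of_trees 2 (extension_graph A (image_set T) [])"
  proof (rule disjoint_union_of_trees_2)
    show "undirected_tree (extension_copy T 0 [])" "undirected_tree (extension_copy T 1 [])"
      using undirected_tree_extension_copy[OF tree] by simp_all
    show "disjnt (pverts (extension_copy T 0 [])) (pverts (extension_copy T 1 []))"
      by (rule disjnt_extension_copies)
    show "pverts (extension_graph A (image_set T) []) =
        pverts (extension_copy T 0 []) \<union> pverts (extension_copy T 1 [])"
      \<comment> \<open>The 0 is arbitrary: the empty word is \<open>\<delta> i []\<close> for
        either state.\<close>
      using pverts_extension_graph_image_set[OF T, of "[]" 0] by (simp add: occurrence_states_def)
    show "parcs (extension_graph A (image_set T) []) =
        parcs (extension_copy T 0 []) \<union> parcs (extension_copy T 1 [])"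
      using parcs_extension_graph_image_set[OF T, of "[]" 0] by (simp add: occurrence_states_def)
  qed
  ultimately show ?thesis
    using biextendable_image_set[OF bi] by (simp add: tree_set_def)
qed

text \<open>The inverse of an output word is an output of the reversed input, so closure under
  reversal becomes closure under inverses.\<close>

lemma laminary_set_image_set:
  assumes bi: "biextendable \<Sigma> T" and reversal: "\<forall>w\<in>T. rev w \<in> T"
  shows "laminary_set A \<theta> (image_set T)"
proof -
  have T: "T \<subseteq> lists \<Sigma>" using bi by (simp add: biextendable_def factorial_set_def)
  have "reduced_word A \<theta> w \<and> inverse_word \<theta> w \<in> image_set T" if "w \<in> image_set T" for w
  proof -
    from that obtain i u where i: "i \<in> {0, 1}" and u: "u \<in> T" "w = \<delta> i u"
      by (auto simp: in_image_set_iff)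
    have lists: "u \<in> lists \<Sigma>" using T u(1) by blast
    have "1 - end_state i u \<in> {0, 1}" using end_state_in[OF lists i] by auto
    moreover have "rev u \<in> T" using reversal u(1) by blast
    ultimately have "inverse_word \<theta> w \<in> image_set T"
      unfolding in_image_set_iff u(2) inverse_word_doubling_map[OF lists i]
      by (intro bexI[of _ "1 - end_state i u"] bexI[of _ "rev u"] HOL.refl)
    then show ?thesis using reduced_word_doubling_map[OF lists i] u(2) by simp
  qed
  then show ?thesis
    using involution_on_output biextendable_image_set[OF bi] by (simp add: laminary_set_def)
qed

end

theorem theorem4p20:
  fixes \<Sigma> :: "'s set" and A :: "'a set" and T :: "'s list set" and E :: "('s, 'a) edge set"
  assumes "tree_set \<Sigma> 1 T"
    and "\<forall>w\<in>T. rev w \<in> T"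
    and "doubling_transducer \<Sigma> A E"
  shows "specular_set A (doubling_involution E) (doubling_map E 0 ` T \<union> doubling_map E 1 ` T)"
proof -
  interpret doubling \<Sigma> A E by unfold_locales (fact assms(3))
  have "biextendable \<Sigma> T" using assms(1) by (simp add: tree_set_def)
  then show ?thesis
    using laminary_set_image_set[OF _ assms(2)] tree_set_image_set[OF assms(1)]
    by (simp add: specular_set_def image_set_def)
qed

end
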